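(* Let $n\ge 1$ be an integer. If there exists a cyclic $n$-difference cover $D=\{d_1,d_2,\ldots,d_k\}$ (with $k$ elements), then $\mu(n)\le k-1$, where $\mu(n)$ is the $n$th mediation number.
   Context: A subset $D=\{d_1,d_2,\ldots,d_k\}$ of $\mathbb{Z}_n$ (the integers modulo $n$) is called a cyclic $n$-difference cover if the collection of values $d_i-d_j \pmod n$, $i,j\in\{1,\ldots,k\}$, contains every element of $\mathbb{Z}_n$ at least once. Digraphs are finite, without loops or parallel arcs (both arcs $xy$ and $yx$ may be present). For a digraph $H$ and a vertex $x$, let $N^-(x)=\{y: yx\in A(H)\}$ and $N^-[x]=\{x\}\cup N^-(x)$; $\Delta^-(H)$ is the maximum of $|N^-(x)|$ over vertices $x$. A digraph $H$ is mediated if for every pair $x,y$ of distinct vertices there is a vertex $z$ (possibly $z=x$ or $z=y$) such that $x,y\in N^-[z]$. The $n$th mediation number $\mu(n)$ is the minimum of $\Delta^-(H)$ over all mediated digraphs $H$ on $n$ vertices. *)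

theory Defs
  imports "Graph_Theory.Pair_Digraph"
begin

section \<open>Cyclic difference covers\<close>

text \<open>The integers modulo \<open>n\<close> are represented by their residues \<open>{0..<n}\<close>.\<close>

definition cyclic_difference_cover :: "nat \<Rightarrow> int set \<Rightarrow> bool" where
  "cyclic_difference_cover n D \<longleftrightarrow>
     D \<subseteq> {0..<int n} \<and>
     (\<forall>z\<in>{0..<int n}. \<exists>x\<in>D. \<exists>y\<in>D. (x - y) mod int n = z)"

section \<open>Mediated digraphs\<close>

text \<open>
  Digraphs are \<^locale>\<open>pair_digraph\<close>s: finite and loopless, with arcs represented as pairs
  (tail, head), so that there are no parallel arcs.
\<close>

definition in_nbhd :: "'a pair_pre_digraph \<Rightarrow> 'a \<Rightarrow> 'a set" where
  "in_nbhd H x = {y. y \<rightarrow>\<^bsub>with_proj H\<^esub> x}"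

definition closed_in_nbhd :: "'a pair_pre_digraph \<Rightarrow> 'a \<Rightarrow> 'a set" where
  "closed_in_nbhd H x = insert x (in_nbhd H x)"

definition max_in_degree :: "'a pair_pre_digraph \<Rightarrow> nat" where
  "max_in_degree H = Max ((\<lambda>x. card (in_nbhd H x)) ` pverts H)"

definition mediated :: "'a pair_pre_digraph \<Rightarrow> bool" where
  "mediated H \<longleftrightarrow> pair_digraph H \<and>
     (\<forall>x\<in>pverts H. \<forall>y\<in>pverts H. x \<noteq> y \<longrightarrow>
        (\<exists>z\<in>pverts H. x \<in> closed_in_nbhd H z \<and> y \<in> closed_in_nbhd H z))"

text \<open>
  The minimum is taken over digraphs whose vertices are natural numbers; every finite digraph
  is isomorphic to one of these, so this is the minimum over all mediated digraphs on \<open>n\<close> vertices,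
  cf. \<open>mediation_number_le\<close> and \<open>mediation_number_attained\<close> below. It is meant for \<open>n \<ge> 1\<close> only
  (for \<open>n = 0\<close>, \<^const>\<open>max_in_degree\<close> is the maximum of the empty set).
\<close>

definition mediation_number :: "nat \<Rightarrow> nat" where
  "mediation_number n =
     (LEAST m. \<exists>H :: nat pair_pre_digraph.
        mediated H \<and> card (pverts H) = n \<and> max_in_degree H = m)"

lemma mediation_number_attained:
  "\<exists>H :: nat pair_pre_digraph.
     mediated H \<and> card (pverts H) = n \<and> max_in_degree H = mediation_number n"
proof -
  define K :: "nat pair_pre_digraph"
    where "K = \<lparr> pverts = {..<n}, parcs = {(x, y). x < n \<and> y < n \<and> x \<noteq> y} \<rparr>"
  have "finite (parcs K)"
    by (rule finite_subset[of _ "{..<n} \<times> {..<n}"]) (auto simp: K_def)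
  then have "pair_digraph K"
    by unfold_locales (auto simp: K_def)
  moreover have "\<exists>z\<in>pverts K. x \<in> closed_in_nbhd K z \<and> y \<in> closed_in_nbhd K z"
    if "x \<in> pverts K" "y \<in> pverts K" "x \<noteq> y" for x y
    using that by (intro bexI[of _ y]) (auto simp: K_def closed_in_nbhd_def in_nbhd_def)
  ultimately have "mediated K"
    unfolding mediated_def by blast
  moreover have "card (pverts K) = n"
    by (simp add: K_def)
  ultimately have "\<exists>m. \<exists>H :: nat pair_pre_digraph.
      mediated H \<and> card (pverts H) = n \<and> max_in_degree H = m"
    by blast
  from LeastI_ex[OF this] show ?thesis
    unfolding mediation_number_def .
qed

lemma mediation_number_le:
  fixes H :: "'a pair_pre_digraph"
  assumes "mediated H"
  shows "mediation_number (card (pverts H)) \<le> max_in_degree H"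
proof -
  interpret pair_digraph H
    using assms by (simp add: mediated_def)
  obtain f :: "'a \<Rightarrow> nat" where f: "inj_on f (pverts H)"
    using finite_imp_inj_to_nat_seg[OF pair_finite_verts] by blast
  define H' :: "nat pair_pre_digraph"
    where "H' = \<lparr> pverts = f ` pverts H, parcs = map_prod f f ` parcs H \<rparr>"
  have nbhd_sub: "in_nbhd H x \<subseteq> pverts H" for x
    by (auto simp: in_nbhd_def dest: in_arcsD1)
  have nbhd: "in_nbhd H' (f x) = f ` in_nbhd H x" if "x \<in> pverts H" for x
  proof (intro equalityI subsetI)
    fix y assume "y \<in> in_nbhd H' (f x)"
    then obtain a b where ab: "(a, b) \<in> parcs H" "y = f a" "f x = f b"
      by (auto simp: in_nbhd_def H'_def)
    then have "b = x"
      using that inj_on_eq_iff[OF f] in_arcsD2[OF ab(1)] by simp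
    with ab show "y \<in> f ` in_nbhd H x"
      by (auto simp: in_nbhd_def)
  next
    fix y assume "y \<in> f ` in_nbhd H x"
    then show "y \<in> in_nbhd H' (f x)"
      by (auto simp: in_nbhd_def H'_def intro: rev_image_eqI)
  qed
  have "pair_digraph H'"
  proof
    fix e assume "e \<in> parcs H'"
    then obtain a b where ab: "(a, b) \<in> parcs H" "e = (f a, f b)"
      by (auto simp: H'_def)
    then have *: "a \<in> pverts H" "b \<in> pverts H" "a \<noteq> b"
      using in_arcsD1[OF ab(1)] in_arcsD2[OF ab(1)] pair_no_loops[OF ab(1)] by simp_all
    then show "fst e \<in> pverts H'" "snd e \<in> pverts H'"
      using ab by (simp_all add: H'_def)
    show "fst e \<noteq> snd e"
      using ab(2) * by (simp add: inj_on_eq_iff[OF f])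
  qed (simp_all add: H'_def pair_finite_verts pair_finite_arcs)
  moreover have "\<exists>z\<in>pverts H'. x \<in> closed_in_nbhd H' z \<and> y \<in> closed_in_nbhd H' z"
    if xy: "x \<in> pverts H'" "y \<in> pverts H'" "x \<noteq> y" for x y
  proof -
    obtain u v where uv: "u \<in> pverts H" "v \<in> pverts H" "x = f u" "y = f v" "u \<noteq> v"
      using xy by (auto simp: H'_def)
    then obtain z where z: "z \<in> pverts H" "u \<in> closed_in_nbhd H z" "v \<in> closed_in_nbhd H z"
      using assms unfolding mediated_def by blast
    then show ?thesis
      using uv nbhd[OF z(1)]
      by (intro bexI[of _ "f z"]) (auto simp: closed_in_nbhd_def H'_def)
  qed
  ultimately have "mediated H'"
    unfolding mediated_def by blast
  moreover have "card (pverts H') = card (pverts H)"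
    using f by (simp add: H'_def card_image)
  moreover have "max_in_degree H' = max_in_degree H"
  proof -
    have "card (in_nbhd H' (f x)) = card (in_nbhd H x)" if "x \<in> pverts H" for x
      using nbhd[OF that] card_image[OF inj_on_subset[OF f nbhd_sub]] by simp
    then have "(\<lambda>x. card (in_nbhd H' x)) ` pverts H' = (\<lambda>x. card (in_nbhd H x)) ` pverts H"
      by (simp add: H'_def image_image)
    then show ?thesis
      by (simp add: max_in_degree_def)
  qed
  ultimately have "\<exists>H' :: nat pair_pre_digraph.
      mediated H' \<and> card (pverts H') = card (pverts H) \<and> max_in_degree H' = max_in_degree H"
    by blast
  then show ?thesis
    unfolding mediation_number_def by (rule Least_le)
qed

end

(* Fix e in D and translate D by -e, so that 0 is in D. Take as closed in-neighbourhoods the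
   translates z + D, z in Z_n: each contains z and has k elements. Two vertices u, v with
   u - v = a - b, where a, b are in D, both lie in z + D for z = u - a = v - b. *)

theory Submission
  imports Defs
begin

text \<open>The shift by \<open>-e\<close> sits in the arc relation, so \<open>D\<close> itself
  stays unchanged. The choice \<open>d = e\<close> would give a loop at \<open>x\<close>;
  \<open>y \<noteq> x\<close> removes it, and \<open>closed_in_nbhd\<close> puts \<open>x\<close>
  back.\<close>

definition translate_digraph :: "nat \<Rightarrow> int set \<Rightarrow> int \<Rightarrow> int pair_pre_digraph" where
  "translate_digraph n D e =
     \<lparr> pverts = {0..<int n},
       parcs = {(y, x). x \<in> {0..<int n} \<and> y \<in> {0..<int n} \<and> y \<noteq> x \<and>
                        (\<exists>d\<in>D. y = (x + d - e) mod int n)} \<rparr>"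

lemma pverts_translate_digraph [simp]: "pverts (translate_digraph n D e) = {0..<int n}"
  by (simp add: translate_digraph_def)

lemma in_nbhd_translate_digraph:
  "in_nbhd (translate_digraph n D e) x =
     {y. x \<in> {0..<int n} \<and> y \<in> {0..<int n} \<and> y \<noteq> x \<and> (\<exists>d\<in>D. y = (x + d - e) mod int n)}"
  by (simp add: in_nbhd_def translate_digraph_def)

lemma pair_digraph_translate_digraph: "pair_digraph (translate_digraph n D e)"
proof -
  have "finite (parcs (translate_digraph n D e))"
    by (rule finite_subset[of _ "{0..<int n} \<times> {0..<int n}"]) (auto simp: translate_digraph_def)
  then show ?thesis
    by unfold_locales (auto simp: translate_digraph_def)
qed

text \<open>Includes \<open>x = z\<close>, where no arc exists, which spares a case distinction in
  the proof of mediation.\<close>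

lemma closed_in_nbhd_translate_digraphI:
  assumes "z \<in> {0..<int n}" "x \<in> {0..<int n}" "d \<in> D" "x = (z + d - e) mod int n"
  shows "x \<in> closed_in_nbhd (translate_digraph n D e) z"
  using assms by (auto simp: closed_in_nbhd_def in_nbhd_translate_digraph)

text \<open>The shift cancels in differences, so this holds for every \<open>e\<close>.\<close>

lemma mediated_translate_digraph:
  assumes "n \<ge> 1" and cover: "cyclic_difference_cover n D"
  shows "mediated (translate_digraph n D e)"
  unfolding mediated_def
proof (intro conjI ballI impI)
  show "pair_digraph (translate_digraph n D e)"
    by (rule pair_digraph_translate_digraph)
next
  fix u v
  assume "u \<in> pverts (translate_digraph n D e)" "v \<in> pverts (translate_digraph n D e)"
  then have uv: "u \<in> {0..<int n}" "v \<in> {0..<int n}"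
    by simp_all
  have "(u - v) mod int n \<in> {0..<int n}"
    using assms(1) by simp
  then obtain a b where ab: "a \<in> D" "b \<in> D" "(a - b) mod int n = (u - v) mod int n"
    using cover unfolding cyclic_difference_cover_def by blast
  \<comment> \<open>The solution of \<open>z + a - e = u\<close> modulo \<open>n\<close>.\<close>
  define z where "z = (u - a + e) mod int n"
  have z: "z \<in> {0..<int n}"
    using assms(1) by (simp add: z_def)
  \<comment> \<open>Written with \<open>a - d\<close> so that \<open>d = a\<close> gives
    \<open>u\<close> and \<open>d = b\<close> exposes the difference \<open>a - b\<close>.\<close>
  have shift: "(z + d - e) mod int n = (u - (a - d)) mod int n" for d
  proof -
    have "(z + d - e) mod int n = (z + (d - e)) mod int n"
      by (simp add: algebra_simps)
    also have "\<dots> = (u - a + e + (d - e)) mod int n"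
      unfolding z_def by (rule mod_add_left_eq)
    finally show ?thesis
      by (simp add: algebra_simps)
  qed
  have "u = (z + a - e) mod int n"
    using uv by (simp add: shift)
  moreover have "v = (z + b - e) mod int n"
  proof -
    \<comment> \<open>Modulo \<open>n\<close>, \<open>a - b\<close> may be replaced by
      \<open>u - v\<close>, which leaves \<open>v\<close>.\<close>
    have "(u - (a - b)) mod int n = (u - (u - v)) mod int n"
      using ab(3) by (rule mod_diff_cong[OF refl])
    then show ?thesis
      using uv by (simp add: shift)
  qed
  ultimately show "\<exists>z\<in>pverts (translate_digraph n D e).
      u \<in> closed_in_nbhd (translate_digraph n D e) z \<and>
      v \<in> closed_in_nbhd (translate_digraph n D e) z"
    using z uv ab(1,2) closed_in_nbhd_translate_digraphI by (intro bexI[of _ z]) auto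
qed

text \<open>The element \<open>e\<close> of \<open>D\<close> yields only \<open>x\<close> itself, so
  every in-neighbour comes from \<open>D - {e}\<close>.\<close>

lemma card_in_nbhd_translate_digraph_le:
  assumes "finite D" "e \<in> D"
  shows "card (in_nbhd (translate_digraph n D e) x) \<le> card D - 1"
proof -
  have "in_nbhd (translate_digraph n D e) x \<subseteq> (\<lambda>d. (x + d - e) mod int n) ` (D - {e})"
    by (auto simp: in_nbhd_translate_digraph)
  then have "card (in_nbhd (translate_digraph n D e) x) \<le> card (D - {e})"
    using assms(1) by (meson finite_Diff surj_card_le)
  then show ?thesis
    using assms by simp
qed

theorem proposition5p6:
  fixes n k :: nat and D :: "int set"
  assumes "n \<ge> 1"
    and "cyclic_difference_cover n D"
    and "card D = k"
  shows "int (mediation_number n) \<le> int k - 1"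
proof -
  have fin: "finite D"
    using assms(2) finite_subset unfolding cyclic_difference_cover_def by blast
  \<comment> \<open>The difference 0 must be represented, so \<open>D\<close> is nonempty and
    supplies \<open>e\<close>.\<close>
  have "0 \<in> {0..<int n}"
    using assms(1) by simp
  then obtain e where e: "e \<in> D"
    using assms(2) unfolding cyclic_difference_cover_def by blast
  let ?H = "translate_digraph n D e"
  have "mediation_number n \<le> max_in_degree ?H"
    using mediation_number_le[OF mediated_translate_digraph[OF assms(1,2)], of e] by simp
  \<comment> \<open>\<open>n \<ge> 1\<close> ensures that the maximum ranges over a nonempty
    set.\<close>
  also have "\<dots> \<le> k - 1"
    unfolding max_in_degree_def
    using assms(1,3) card_in_nbhd_translate_digraph_le[OF fin e] by (intro Max.boundedI) auto
  finally have "mediation_number n \<le> k - 1" .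
  \<comment> \<open>Rules out truncation in the natural number \<open>k - 1\<close>, so the bound
    carries over to integers.\<close>
  moreover have "k \<ge> 1"
    using assms(3) fin e card_gt_0_iff[of D] by auto
  ultimately show ?thesis
    by linarith
qed

end
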